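(* The forward operators $K_n$ of the Born series satisfy $$K_0=u_0,\qquad K_1=Au_0+B\,u_0\otimes u_0\otimes u_0,$$ and, for every $n\ge0$, $$K_{n+1}=AK_n+B\sum_{\substack{(i_1,i_2,i_3)\\ i_1+i_2+i_3=n\\ 0\le i_1,i_2,i_3\le n}}K_{i_1}\otimes K_{i_2}\otimes K_{i_3},$$ where the sum runs over ordered triples of nonnegative integers.
   Context: $\Omega\subset\mathbb{R}^d$, $d>2$, is a bounded domain with smooth boundary, $k>0$, and $u_0\in C(\overline\Omega)$ is real valued and solves $\Delta u_0+k^2u_0=0$ in $\Omega$, $\partial u_0/\partial\nu=g$ on $\partial\Omega$ for a given real source $g$. $G$ is the Green's function: $\Delta_xG(x,y)+k^2G(x,y)=\delta(x-y)$ in $\Omega$, $\partial G/\partial\nu_y=0$ on $\partial\Omega$ (assumed to exist). A multilinear operator of order $l$ is an $l$-linear map $T_l:([L^\infty(\Omega)]^2)^l\to C(\overline\Omega)$; order-zero operators are elements of $C(\overline\Omega)$. Arguments are pairs $\zeta=(\alpha,\beta)$. For $v\in C(\overline\Omega)$ and $\zeta=(\alpha,\beta)$ set $$a(v,\zeta)(x)=-k^2\int_\Omega G(x,y)\alpha(y)v(y)\,dy,\qquad b(v,\zeta)(x)=-k^2\int_\Omega G(x,y)\beta(y)v(y)\,dy.$$ For $T_l$ of order $l$, define operators of order $l+1$ by $AT_l(\zeta_1,\dots,\zeta_{l+1})=a(T_l(\zeta_1,\dots,\zeta_l),\zeta_{l+1})$ and $BT_l(\zeta_1,\dots,\zeta_{l+1})=b(T_l(\zeta_1,\dots,\zeta_l),\zeta_{l+1})$.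 For $T_l,T_j$ of orders $l,j$, the tensor product $T_l\otimes T_j$ of order $l+j$ is the pointwise product $T_l\otimes T_j(\zeta_1,\dots,\zeta_{l+j})=T_l(\zeta_1,\dots,\zeta_l)\,T_j(\zeta_{l+1},\dots,\zeta_{l+j})$. Finite formal sums of multilinear operators of various orders (elements of the direct sum over orders) are considered, and $A$, $B$, $\otimes$ are extended to them by (bi)linearity. In an expression such as $B\,v\otimes v\otimes v$, $B$ is applied to the whole tensor product. The iterates, as formal sums of multilinear operators, start from $u_0$ and are $u_{n+1}=u_0+Au_n+B\,u_n\otimes u_n\otimes u_n$ for $n\ge0$. The forward operator $K_n$ is the sum of all multilinear operators of order exactly $n$ in $u_n$. *)

theory Defs
  imports "HOL-Analysis.Analysis" "HOL-Library.Function_Algebras"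
begin

section \<open>Smooth functions, smooth boundaries, normal derivatives\<close>

abbreviation dir_deriv :: "'a::euclidean_space \<Rightarrow> ('a \<Rightarrow> real) \<Rightarrow> 'a \<Rightarrow> real" where
  "dir_deriv v f \<equiv> (\<lambda>x. frechet_derivative f (at x) v)"

(* Meant for open S. *)
primrec Ck_on :: "nat \<Rightarrow> 'a::euclidean_space set \<Rightarrow> ('a \<Rightarrow> real) \<Rightarrow> bool" where
  "Ck_on 0 S f \<longleftrightarrow> continuous_on S f"
| "Ck_on (Suc n) S f \<longleftrightarrow>
     (\<forall>x\<in>S. f differentiable (at x)) \<and> (\<forall>i\<in>Basis. Ck_on n S (dir_deriv i f))"

definition smooth_on :: "'a::euclidean_space set \<Rightarrow> ('a \<Rightarrow> real) \<Rightarrow> bool" where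
  "smooth_on S f \<longleftrightarrow> (\<forall>n. Ck_on n S f)"

definition gradient :: "('a::euclidean_space \<Rightarrow> real) \<Rightarrow> 'a \<Rightarrow> 'a" where
  "gradient f x = (\<Sum>i\<in>Basis. dir_deriv i f x *\<^sub>R i)"

definition laplacian :: "('a::euclidean_space \<Rightarrow> real) \<Rightarrow> 'a \<Rightarrow> real" where
  "laplacian f x = (\<Sum>i\<in>Basis. dir_deriv i (dir_deriv i f) x)"

(* Near p the open set \<Omega> is the sublevel set {\<rho> < 0} of a smooth function without critical
   points; for p in the frontier this forces \<rho> p = 0, and \<Omega> lies on one side of its boundary. *)
definition local_defining_function ::
    "'a::euclidean_space set \<Rightarrow> 'a \<Rightarrow> 'a set \<Rightarrow> ('a \<Rightarrow> real) \<Rightarrow> bool" where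
  "local_defining_function \<Omega> p U \<rho> \<longleftrightarrow>
     open U \<and> p \<in> U \<and> smooth_on U \<rho> \<and> (\<forall>x\<in>U. gradient \<rho> x \<noteq> 0) \<and> \<Omega> \<inter> U = {x \<in> U. \<rho> x < 0}"

definition smooth_bounded_domain :: "'a::euclidean_space set \<Rightarrow> bool" where
  "smooth_bounded_domain \<Omega> \<longleftrightarrow>
     open \<Omega> \<and> connected \<Omega> \<and> \<Omega> \<noteq> {} \<and> bounded \<Omega> \<and>
     (\<forall>p\<in>frontier \<Omega>. \<exists>U \<rho>. local_defining_function \<Omega> p U \<rho>)"

definition outward_unit_normal :: "'a::euclidean_space set \<Rightarrow> 'a \<Rightarrow> 'a \<Rightarrow> bool" where
  "outward_unit_normal \<Omega> p \<nu> \<longleftrightarrow>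
     (\<exists>U \<rho>. local_defining_function \<Omega> p U \<rho> \<and> \<nu> = sgn (gradient \<rho> p))"

(* One-sided, since f is only meaningful on the closure of \<Omega>. *)
definition has_normal_derivative ::
    "'a::euclidean_space set \<Rightarrow> ('a \<Rightarrow> real) \<Rightarrow> 'a \<Rightarrow> real \<Rightarrow> bool" where
  "has_normal_derivative \<Omega> f p D \<longleftrightarrow>
     (\<exists>\<nu>. outward_unit_normal \<Omega> p \<nu> \<and>
          ((\<lambda>t. (f p - f (p - t *\<^sub>R \<nu>)) / t) \<longlongrightarrow> D) (at_right 0))"


section \<open>The background field and the Green's function\<close>

definition neumann_helmholtz_solution ::
    "'a::euclidean_space set \<Rightarrow> real \<Rightarrow> ('a \<Rightarrow> real) \<Rightarrow> ('a \<Rightarrow> real) \<Rightarrow> bool" where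
  "neumann_helmholtz_solution \<Omega> k g u \<longleftrightarrow>
     continuous_on (closure \<Omega>) u \<and> Ck_on 2 \<Omega> u \<and>
     (\<forall>x\<in>\<Omega>. laplacian u x + k\<^sup>2 * u x = 0) \<and>
     (\<forall>x\<in>frontier \<Omega>. has_normal_derivative \<Omega> u x (g x))"

definition test_function :: "'a::euclidean_space set \<Rightarrow> ('a \<Rightarrow> real) \<Rightarrow> bool" where
  "test_function \<Omega> \<phi> \<longleftrightarrow>
     smooth_on UNIV \<phi> \<and> (\<exists>C. compact C \<and> C \<subseteq> \<Omega> \<and> (\<forall>x. x \<notin> C \<longrightarrow> \<phi> x = 0))"

(* The equation in x holds in the sense of distributions. *)
definition neumann_greens_function ::
    "'a::euclidean_space set \<Rightarrow> real \<Rightarrow> ('a \<Rightarrow> 'a \<Rightarrow> real) \<Rightarrow> bool" where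
  "neumann_greens_function \<Omega> k G \<longleftrightarrow>
     (\<forall>y\<in>\<Omega>. \<forall>C. compact C \<and> C \<subseteq> \<Omega> \<longrightarrow> integrable (lebesgue_on C) (\<lambda>x. G x y)) \<and>
     (\<forall>y\<in>\<Omega>. \<forall>\<phi>. test_function \<Omega> \<phi> \<longrightarrow>
        integral\<^sup>L (lebesgue_on \<Omega>) (\<lambda>x. G x y * (laplacian \<phi> x + k\<^sup>2 * \<phi> x)) = \<phi> y) \<and>
     (\<forall>x\<in>\<Omega>. \<forall>y\<in>frontier \<Omega>. has_normal_derivative \<Omega> (G x) y 0)"

(* Elements of L-infinity are represented by functions; identification almost everywhere is
   imposed on the multilinear operators below. *)
definition Linf :: "'a::euclidean_space set \<Rightarrow> ('a \<Rightarrow> real) set" where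
  "Linf \<Omega> = {f. f \<in> borel_measurable (lebesgue_on \<Omega>) \<and> (\<exists>c. AE x in lebesgue_on \<Omega>. \<bar>f x\<bar> \<le> c)}"

(* The kernel G defines an operator from L-infinity(\<Omega>) to C(closure \<Omega>). This is what makes a(v,\<zeta>) and
   b(v,\<zeta>) elements of C(closure \<Omega>); Green's functions on smooth domains have this property because
   their singularity on the diagonal is weak. *)
definition kernel_Linf_to_C :: "'a::euclidean_space set \<Rightarrow> ('a \<Rightarrow> 'a \<Rightarrow> real) \<Rightarrow> bool" where
  "kernel_Linf_to_C \<Omega> G \<longleftrightarrow>
     (\<forall>x\<in>closure \<Omega>. integrable (lebesgue_on \<Omega>) (G x)) \<and>
     (\<forall>f\<in>Linf \<Omega>. continuous_on (closure \<Omega>) (\<lambda>x. integral\<^sup>L (lebesgue_on \<Omega>) (\<lambda>y. G x y * f y)))"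


section \<open>Multilinear operators\<close>

type_synonym 'a pot = "('a \<Rightarrow> real) \<times> ('a \<Rightarrow> real)"
type_synonym 'a oper = "'a pot list \<Rightarrow> 'a \<Rightarrow> real"

definition args :: "'a::euclidean_space set \<Rightarrow> nat \<Rightarrow> 'a pot list set" where
  "args \<Omega> l = {\<zeta>s. length \<zeta>s = l \<and> set \<zeta>s \<subseteq> Linf \<Omega> \<times> Linf \<Omega>}"

(* Functions are extended by zero off the closure, so that equality of functions is equality in
   C(closure \<Omega>). *)
definition C_closure :: "'a::euclidean_space set \<Rightarrow> ('a \<Rightarrow> real) set" where
  "C_closure \<Omega> = {v. continuous_on (closure \<Omega>) v \<and> (\<forall>x. x \<notin> closure \<Omega> \<longrightarrow> v x = 0)}"

definition pot_comb :: "real \<Rightarrow> 'a pot \<Rightarrow> real \<Rightarrow> 'a pot \<Rightarrow> 'a pot" where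
  "pot_comb c \<zeta> d \<zeta>' = (\<lambda>x. c * fst \<zeta> x + d * fst \<zeta>' x, \<lambda>x. c * snd \<zeta> x + d * snd \<zeta>' x)"

definition pot_AE_eq :: "'a::euclidean_space set \<Rightarrow> 'a pot \<Rightarrow> 'a pot \<Rightarrow> bool" where
  "pot_AE_eq \<Omega> \<zeta> \<zeta>' \<longleftrightarrow> (AE x in lebesgue_on \<Omega>. fst \<zeta> x = fst \<zeta>' x \<and> snd \<zeta> x = snd \<zeta>' x)"

(* Multilinear operators of order l, extended by zero to lists that are not admissible arguments, so that
   equality of HOL functions is equality of operators. *)
definition multilinear_ops :: "'a::euclidean_space set \<Rightarrow> nat \<Rightarrow> 'a oper set" where
  "multilinear_ops \<Omega> l = {T.
     (\<forall>\<zeta>s. \<zeta>s \<notin> args \<Omega> l \<longrightarrow> T \<zeta>s = 0) \<and>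
     (\<forall>\<zeta>s\<in>args \<Omega> l. T \<zeta>s \<in> C_closure \<Omega>) \<and>
     (\<forall>\<zeta>s\<in>args \<Omega> l. \<forall>\<zeta>s'\<in>args \<Omega> l. list_all2 (pot_AE_eq \<Omega>) \<zeta>s \<zeta>s' \<longrightarrow> T \<zeta>s = T \<zeta>s') \<and>
     (\<forall>\<zeta>s\<in>args \<Omega> l. \<forall>i<l. \<forall>\<zeta>\<in>Linf \<Omega> \<times> Linf \<Omega>. \<forall>c d.
        T (\<zeta>s[i := pot_comb c (\<zeta>s ! i) d \<zeta>]) = (\<lambda>x. c * T \<zeta>s x + d * T (\<zeta>s[i := \<zeta>]) x))}"

definition op_const :: "'a::euclidean_space set \<Rightarrow> ('a \<Rightarrow> real) \<Rightarrow> 'a oper" where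
  "op_const \<Omega> v \<zeta>s = (if \<zeta>s \<in> args \<Omega> 0 then (\<lambda>x. if x \<in> closure \<Omega> then v x else 0) else 0)"

definition volume_potential ::
    "'a::euclidean_space set \<Rightarrow> real \<Rightarrow> ('a \<Rightarrow> 'a \<Rightarrow> real) \<Rightarrow> ('a \<Rightarrow> real) \<Rightarrow> ('a \<Rightarrow> real) \<Rightarrow> 'a \<Rightarrow> real" where
  "volume_potential \<Omega> k G \<gamma> v x =
     (if x \<in> closure \<Omega> then - k\<^sup>2 * integral\<^sup>L (lebesgue_on \<Omega>) (\<lambda>y. G x y * \<gamma> y * v y) else 0)"

definition a_map ::
    "'a::euclidean_space set \<Rightarrow> real \<Rightarrow> ('a \<Rightarrow> 'a \<Rightarrow> real) \<Rightarrow> ('a \<Rightarrow> real) \<Rightarrow> 'a pot \<Rightarrow> 'a \<Rightarrow> real" where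
  "a_map \<Omega> k G v \<zeta> = volume_potential \<Omega> k G (fst \<zeta>) v"

definition b_map ::
    "'a::euclidean_space set \<Rightarrow> real \<Rightarrow> ('a \<Rightarrow> 'a \<Rightarrow> real) \<Rightarrow> ('a \<Rightarrow> real) \<Rightarrow> 'a pot \<Rightarrow> 'a \<Rightarrow> real" where
  "b_map \<Omega> k G v \<zeta> = volume_potential \<Omega> k G (snd \<zeta>) v"

(* In the next three definitions l and j are the orders of T and S. *)
definition op_A ::
    "'a::euclidean_space set \<Rightarrow> real \<Rightarrow> ('a \<Rightarrow> 'a \<Rightarrow> real) \<Rightarrow> nat \<Rightarrow> 'a oper \<Rightarrow> 'a oper" where
  "op_A \<Omega> k G l T \<zeta>s = (if \<zeta>s \<in> args \<Omega> (Suc l) then a_map \<Omega> k G (T (take l \<zeta>s)) (\<zeta>s ! l) else 0)"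

definition op_B ::
    "'a::euclidean_space set \<Rightarrow> real \<Rightarrow> ('a \<Rightarrow> 'a \<Rightarrow> real) \<Rightarrow> nat \<Rightarrow> 'a oper \<Rightarrow> 'a oper" where
  "op_B \<Omega> k G l T \<zeta>s = (if \<zeta>s \<in> args \<Omega> (Suc l) then b_map \<Omega> k G (T (take l \<zeta>s)) (\<zeta>s ! l) else 0)"

definition op_tensor ::
    "'a::euclidean_space set \<Rightarrow> nat \<Rightarrow> nat \<Rightarrow> 'a oper \<Rightarrow> 'a oper \<Rightarrow> 'a oper" where
  "op_tensor \<Omega> l j T S \<zeta>s =
     (if \<zeta>s \<in> args \<Omega> (l + j) then (\<lambda>x. T (take l \<zeta>s) x * S (drop l \<zeta>s) x) else 0)"


section \<open>Formal sums of multilinear operators and the iterates\<close>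

(* The direct sum over all orders: F l is the part of order l. Addition is pointwise. *)
type_synonym 'a formal = "nat \<Rightarrow> 'a oper"

definition formal_sums :: "'a::euclidean_space set \<Rightarrow> 'a formal set" where
  "formal_sums \<Omega> = {F. (\<forall>l. F l \<in> multilinear_ops \<Omega> l) \<and> finite {l. F l \<noteq> 0}}"

definition formal_const :: "'a::euclidean_space set \<Rightarrow> ('a \<Rightarrow> real) \<Rightarrow> 'a formal" where
  "formal_const \<Omega> v l = (if l = 0 then op_const \<Omega> v else 0)"

definition formal_A ::
    "'a::euclidean_space set \<Rightarrow> real \<Rightarrow> ('a \<Rightarrow> 'a \<Rightarrow> real) \<Rightarrow> 'a formal \<Rightarrow> 'a formal" where
  "formal_A \<Omega> k G F n = (case n of 0 \<Rightarrow> 0 | Suc l \<Rightarrow> op_A \<Omega> k G l (F l))"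

definition formal_B ::
    "'a::euclidean_space set \<Rightarrow> real \<Rightarrow> ('a \<Rightarrow> 'a \<Rightarrow> real) \<Rightarrow> 'a formal \<Rightarrow> 'a formal" where
  "formal_B \<Omega> k G F n = (case n of 0 \<Rightarrow> 0 | Suc l \<Rightarrow> op_B \<Omega> k G l (F l))"

definition formal_tensor :: "'a::euclidean_space set \<Rightarrow> 'a formal \<Rightarrow> 'a formal \<Rightarrow> 'a formal" where
  "formal_tensor \<Omega> F H n = (\<Sum>(l, j)\<in>{(l, j). l + j = n}. op_tensor \<Omega> l j (F l) (H j))"

primrec born_iterate ::
    "'a::euclidean_space set \<Rightarrow> real \<Rightarrow> ('a \<Rightarrow> 'a \<Rightarrow> real) \<Rightarrow> ('a \<Rightarrow> real) \<Rightarrow> nat \<Rightarrow> 'a formal" where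
  "born_iterate \<Omega> k G u0 0 = formal_const \<Omega> u0"
| "born_iterate \<Omega> k G u0 (Suc n) =
     formal_const \<Omega> u0 + formal_A \<Omega> k G (born_iterate \<Omega> k G u0 n)
     + formal_B \<Omega> k G (formal_tensor \<Omega>
         (formal_tensor \<Omega> (born_iterate \<Omega> k G u0 n) (born_iterate \<Omega> k G u0 n))
         (born_iterate \<Omega> k G u0 n))"

definition forward_op ::
    "'a::euclidean_space set \<Rightarrow> real \<Rightarrow> ('a \<Rightarrow> 'a \<Rightarrow> real) \<Rightarrow> ('a \<Rightarrow> real) \<Rightarrow> nat \<Rightarrow> 'a oper" where
  "forward_op \<Omega> k G u0 n = born_iterate \<Omega> k G u0 n n"


section \<open>The iterates are formal sums of multilinear operators\<close>

lemma Linf_mult: "f * h \<in> Linf \<Omega>" if "f \<in> Linf \<Omega>" "h \<in> Linf \<Omega>" for f h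
proof -
  from that obtain c d where c: "AE x in lebesgue_on \<Omega>. \<bar>f x\<bar> \<le> c"
    and d: "AE x in lebesgue_on \<Omega>. \<bar>h x\<bar> \<le> d"
    and m: "f \<in> borel_measurable (lebesgue_on \<Omega>)" "h \<in> borel_measurable (lebesgue_on \<Omega>)"
    by (auto simp: Linf_def)
  have "AE x in lebesgue_on \<Omega>. \<bar>(f * h) x\<bar> \<le> c * d"
    using c d
  proof eventually_elim
    case (elim x)
    then show ?case by (auto simp: abs_mult intro!: mult_mono)
  qed
  moreover have "f * h \<in> borel_measurable (lebesgue_on \<Omega>)"
    unfolding times_fun_def using m by simp
  ultimately show ?thesis unfolding Linf_def by blast
qed

lemma Linf_comb: "(\<lambda>x. c * f x + d * h x) \<in> Linf \<Omega>" if "f \<in> Linf \<Omega>" "h \<in> Linf \<Omega>"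
proof -
  from that obtain p q where p: "AE x in lebesgue_on \<Omega>. \<bar>f x\<bar> \<le> p"
    and q: "AE x in lebesgue_on \<Omega>. \<bar>h x\<bar> \<le> q"
    and m: "f \<in> borel_measurable (lebesgue_on \<Omega>)" "h \<in> borel_measurable (lebesgue_on \<Omega>)"
    by (auto simp: Linf_def)
  have "AE x in lebesgue_on \<Omega>. \<bar>c * f x + d * h x\<bar> \<le> \<bar>c\<bar> * p + \<bar>d\<bar> * q"
    using p q
  proof eventually_elim
    case (elim x)
    have "\<bar>c * f x + d * h x\<bar> \<le> \<bar>c\<bar> * \<bar>f x\<bar> + \<bar>d\<bar> * \<bar>h x\<bar>"
      by (metis abs_mult abs_triangle_ineq)
    also have "\<dots> \<le> \<bar>c\<bar> * p + \<bar>d\<bar> * q"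
      using elim by (intro add_mono mult_left_mono) auto
    finally show ?case .
  qed
  moreover have "(\<lambda>x. c * f x + d * h x) \<in> borel_measurable (lebesgue_on \<Omega>)"
    using m by simp
  ultimately show ?thesis unfolding Linf_def by blast
qed

lemma C_closure_Linf: "v \<in> Linf \<Omega>" if "open \<Omega>" "bounded \<Omega>" "v \<in> C_closure \<Omega>"
proof -
  have cont: "continuous_on (closure \<Omega>) v" using that by (simp add: C_closure_def)
  have "compact (v ` closure \<Omega>)"
    using cont that by (intro compact_continuous_image) auto
  then obtain c where "\<And>x. x \<in> closure \<Omega> \<Longrightarrow> \<bar>v x\<bar> \<le> c"
    using compact_imp_bounded[of "v ` closure \<Omega>"] by (auto simp: bounded_iff)
  then have "AE x in lebesgue_on \<Omega>. \<bar>v x\<bar> \<le> c"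
    using closure_subset by (intro AE_I2) (auto simp: space_restrict_space)
  moreover have "v \<in> borel_measurable (lebesgue_on \<Omega>)"
    using that continuous_on_subset[OF cont closure_subset]
    by (intro continuous_imp_measurable_on_sets_lebesgue) auto
  ultimately show ?thesis by (auto simp: Linf_def)
qed

lemma kernel_integrable:
  assumes "kernel_Linf_to_C \<Omega> G" "x \<in> closure \<Omega>" "f \<in> Linf \<Omega>"
  shows "integrable (lebesgue_on \<Omega>) (\<lambda>y. G x y * f y)"
proof -
  have G: "integrable (lebesgue_on \<Omega>) (G x)" using assms by (simp add: kernel_Linf_to_C_def)
  obtain c where c: "AE y in lebesgue_on \<Omega>. \<bar>f y\<bar> \<le> c"
    and m: "f \<in> borel_measurable (lebesgue_on \<Omega>)"
    using assms by (auto simp: Linf_def)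
  show ?thesis
  proof (rule Bochner_Integration.integrable_bound)
    show "integrable (lebesgue_on \<Omega>) (\<lambda>y. c * G x y)" using G by simp
    show "(\<lambda>y. G x y * f y) \<in> borel_measurable (lebesgue_on \<Omega>)"
      using G m by simp
    show "AE y in lebesgue_on \<Omega>. norm (G x y * f y) \<le> norm (c * G x y)"
      using c
    proof eventually_elim
      case (elim y)
      then have "\<bar>f y\<bar> * \<bar>G x y\<bar> \<le> \<bar>c\<bar> * \<bar>G x y\<bar>" by (intro mult_right_mono) auto
      then show ?case by (simp add: abs_mult mult.commute)
    qed
  qed
qed

lemma volume_potential_C:
  assumes "kernel_Linf_to_C \<Omega> G" "\<gamma> \<in> Linf \<Omega>" "v \<in> Linf \<Omega>"
  shows "volume_potential \<Omega> k G \<gamma> v \<in> C_closure \<Omega>"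
proof -
  have "continuous_on (closure \<Omega>) (\<lambda>x. integral\<^sup>L (lebesgue_on \<Omega>) (\<lambda>y. G x y * (\<gamma> * v) y))"
    using assms Linf_mult unfolding kernel_Linf_to_C_def by blast
  then have "continuous_on (closure \<Omega>)
      (\<lambda>x. - k\<^sup>2 * integral\<^sup>L (lebesgue_on \<Omega>) (\<lambda>y. G x y * \<gamma> y * v y))"
    by (intro continuous_intros) (simp add: mult.assoc)
  then have "continuous_on (closure \<Omega>) (volume_potential \<Omega> k G \<gamma> v)"
    by (rule continuous_on_eq) (simp add: volume_potential_def)
  then show ?thesis by (simp add: C_closure_def volume_potential_def)
qed

lemma volume_potential_comb_right:
  assumes K: "kernel_Linf_to_C \<Omega> G" and g: "\<gamma> \<in> Linf \<Omega>" and v: "v \<in> Linf \<Omega>" "w \<in> Linf \<Omega>"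
  shows "volume_potential \<Omega> k G \<gamma> (\<lambda>x. c * v x + d * w x) =
         (\<lambda>x. c * volume_potential \<Omega> k G \<gamma> v x + d * volume_potential \<Omega> k G \<gamma> w x)"
proof
  fix x
  show "volume_potential \<Omega> k G \<gamma> (\<lambda>x. c * v x + d * w x) x =
        c * volume_potential \<Omega> k G \<gamma> v x + d * volume_potential \<Omega> k G \<gamma> w x"
  proof (cases "x \<in> closure \<Omega>")
    case True
    have iv: "integrable (lebesgue_on \<Omega>) (\<lambda>y. G x y * \<gamma> y * v y)"
      using kernel_integrable[OF K True Linf_mult[OF g v(1)]] by (simp add: mult.assoc)
    have iw: "integrable (lebesgue_on \<Omega>) (\<lambda>y. G x y * \<gamma> y * w y)"
      using kernel_integrable[OF K True Linf_mult[OF g v(2)]] by (simp add: mult.assoc)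
    have "integral\<^sup>L (lebesgue_on \<Omega>) (\<lambda>y. G x y * \<gamma> y * (c * v y + d * w y))
        = integral\<^sup>L (lebesgue_on \<Omega>) (\<lambda>y. c * (G x y * \<gamma> y * v y) + d * (G x y * \<gamma> y * w y))"
      by (simp add: algebra_simps)
    also have "\<dots> = c * integral\<^sup>L (lebesgue_on \<Omega>) (\<lambda>y. G x y * \<gamma> y * v y)
                   + d * integral\<^sup>L (lebesgue_on \<Omega>) (\<lambda>y. G x y * \<gamma> y * w y)"
      using iv iw by simp
    finally show ?thesis using True by (simp add: volume_potential_def algebra_simps)
  qed (simp add: volume_potential_def)
qed

lemma volume_potential_swap: "volume_potential \<Omega> k G \<gamma> v = volume_potential \<Omega> k G v \<gamma>"
  by (simp add: volume_potential_def fun_eq_iff mult.assoc mult.commute mult.left_commute)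

lemma volume_potential_cong_AE:
  assumes K: "kernel_Linf_to_C \<Omega> G" and g: "\<gamma> \<in> Linf \<Omega>" "\<gamma>' \<in> Linf \<Omega>" and v: "v \<in> Linf \<Omega>"
    and eq: "AE x in lebesgue_on \<Omega>. \<gamma> x = \<gamma>' x"
  shows "volume_potential \<Omega> k G \<gamma> v = volume_potential \<Omega> k G \<gamma>' v"
proof
  fix x
  show "volume_potential \<Omega> k G \<gamma> v x = volume_potential \<Omega> k G \<gamma>' v x"
  proof (cases "x \<in> closure \<Omega>")
    case True
    have "integrable (lebesgue_on \<Omega>) (\<lambda>y. G x y * \<gamma> y * v y)"
      using kernel_integrable[OF K True Linf_mult[OF g(1) v]] by (simp add: mult.assoc)
    moreover have "integrable (lebesgue_on \<Omega>) (\<lambda>y. G x y * \<gamma>' y * v y)"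
      using kernel_integrable[OF K True Linf_mult[OF g(2) v]] by (simp add: mult.assoc)
    ultimately have "integral\<^sup>L (lebesgue_on \<Omega>) (\<lambda>y. G x y * \<gamma> y * v y)
        = integral\<^sup>L (lebesgue_on \<Omega>) (\<lambda>y. G x y * \<gamma>' y * v y)"
      using eq by (intro integral_cong_AE) (auto elim: eventually_mono)
    then show ?thesis by (simp add: volume_potential_def)
  qed (simp add: volume_potential_def)
qed

lemma args_take: "take l \<zeta>s \<in> args \<Omega> l" if "\<zeta>s \<in> args \<Omega> (l + j)"
  using that by (auto simp: args_def dest: in_set_takeD)

lemma args_drop: "drop l \<zeta>s \<in> args \<Omega> j" if "\<zeta>s \<in> args \<Omega> (l + j)"
  using that by (auto simp: args_def dest: in_set_dropD)

lemma args_nth: "\<zeta>s ! i \<in> Linf \<Omega> \<times> Linf \<Omega>" if "\<zeta>s \<in> args \<Omega> l" "i < l"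
  using that by (metis (mono_tags, lifting) args_def mem_Collect_eq nth_mem subsetD)

lemma args_update: "\<zeta>s[i := \<zeta>] \<in> args \<Omega> l" if "\<zeta>s \<in> args \<Omega> l" "\<zeta> \<in> Linf \<Omega> \<times> Linf \<Omega>"
  using that set_update_subset_insert[of \<zeta>s i \<zeta>] by (auto simp: args_def)

lemma pot_comb_Linf:
  "pot_comb c \<zeta> d \<zeta>' \<in> Linf \<Omega> \<times> Linf \<Omega>"
  if "\<zeta> \<in> Linf \<Omega> \<times> Linf \<Omega>" "\<zeta>' \<in> Linf \<Omega> \<times> Linf \<Omega>"
  using that by (auto simp: pot_comb_def intro: Linf_comb)

lemma multilinear_opsI:
  assumes "\<And>\<zeta>s. \<zeta>s \<notin> args \<Omega> l \<Longrightarrow> T \<zeta>s = 0"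
    and "\<And>\<zeta>s. \<zeta>s \<in> args \<Omega> l \<Longrightarrow> T \<zeta>s \<in> C_closure \<Omega>"
    and "\<And>\<zeta>s \<zeta>s'. \<zeta>s \<in> args \<Omega> l \<Longrightarrow> \<zeta>s' \<in> args \<Omega> l \<Longrightarrow> list_all2 (pot_AE_eq \<Omega>) \<zeta>s \<zeta>s' \<Longrightarrow> T \<zeta>s = T \<zeta>s'"
    and "\<And>\<zeta>s i \<zeta> c d. \<zeta>s \<in> args \<Omega> l \<Longrightarrow> i < l \<Longrightarrow> \<zeta> \<in> Linf \<Omega> \<times> Linf \<Omega> \<Longrightarrow>
        T (\<zeta>s[i := pot_comb c (\<zeta>s ! i) d \<zeta>]) = (\<lambda>x. c * T \<zeta>s x + d * T (\<zeta>s[i := \<zeta>]) x)"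
  shows "T \<in> multilinear_ops \<Omega> l"
  using assms unfolding multilinear_ops_def by blast

lemma multilinear_opsD:
  assumes "T \<in> multilinear_ops \<Omega> l"
  shows "\<zeta>s \<notin> args \<Omega> l \<Longrightarrow> T \<zeta>s = 0"
    and "\<zeta>s \<in> args \<Omega> l \<Longrightarrow> T \<zeta>s \<in> C_closure \<Omega>"
    and "\<zeta>s \<in> args \<Omega> l \<Longrightarrow> \<zeta>s' \<in> args \<Omega> l \<Longrightarrow> list_all2 (pot_AE_eq \<Omega>) \<zeta>s \<zeta>s' \<Longrightarrow> T \<zeta>s = T \<zeta>s'"
    and "\<zeta>s \<in> args \<Omega> l \<Longrightarrow> i < l \<Longrightarrow> \<zeta> \<in> Linf \<Omega> \<times> Linf \<Omega> \<Longrightarrow>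
        T (\<zeta>s[i := pot_comb c (\<zeta>s ! i) d \<zeta>]) = (\<lambda>x. c * T \<zeta>s x + d * T (\<zeta>s[i := \<zeta>]) x)"
  using assms unfolding multilinear_ops_def by blast+

lemma multilinear_potential:
  fixes P :: "'a::euclidean_space pot \<Rightarrow> 'a \<Rightarrow> real"
  assumes K: "kernel_Linf_to_C \<Omega> G" and \<Omega>: "open \<Omega>" "bounded \<Omega>" and T: "T \<in> multilinear_ops \<Omega> l"
    and P: "\<And>\<zeta>. \<zeta> \<in> Linf \<Omega> \<times> Linf \<Omega> \<Longrightarrow> P \<zeta> \<in> Linf \<Omega>"
      "\<And>c \<zeta> d \<zeta>'. P (pot_comb c \<zeta> d \<zeta>') = (\<lambda>x. c * P \<zeta> x + d * P \<zeta>' x)"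
      "\<And>\<zeta> \<zeta>'. pot_AE_eq \<Omega> \<zeta> \<zeta>' \<Longrightarrow> AE x in lebesgue_on \<Omega>. P \<zeta> x = P \<zeta>' x"
  shows "(\<lambda>\<zeta>s. if \<zeta>s \<in> args \<Omega> (Suc l) then volume_potential \<Omega> k G (P (\<zeta>s ! l)) (T (take l \<zeta>s)) else 0)
         \<in> multilinear_ops \<Omega> (Suc l)"
proof -
  have tk: "take l \<zeta>s \<in> args \<Omega> l" if "\<zeta>s \<in> args \<Omega> (Suc l)" for \<zeta>s
    using args_take[of \<zeta>s \<Omega> l 1] that by simp
  have TL: "T \<zeta>s \<in> Linf \<Omega>" if "\<zeta>s \<in> args \<Omega> l" for \<zeta>s
    using C_closure_Linf[OF \<Omega>] multilinear_opsD(2)[OF T that] by blast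
  have PL: "P (\<zeta>s ! l) \<in> Linf \<Omega>" if "\<zeta>s \<in> args \<Omega> (Suc l)" for \<zeta>s
    using args_nth[OF that] P(1) by blast
  show ?thesis
  proof (rule multilinear_opsI, goal_cases)
    case (2 \<zeta>s)
    then show ?case using volume_potential_C[OF K PL TL[OF tk]] by simp
  next
    case (3 \<zeta>s \<zeta>s')
    have "list_all2 (pot_AE_eq \<Omega>) (take l \<zeta>s) (take l \<zeta>s')"
      using 3(3) list_all2_takeI by blast
    then have "T (take l \<zeta>s) = T (take l \<zeta>s')"
      using multilinear_opsD(3)[OF T tk tk] 3 by blast
    moreover have "pot_AE_eq \<Omega> (\<zeta>s ! l) (\<zeta>s' ! l)"
      using 3 by (auto simp: args_def list_all2_conv_all_nth)
    ultimately show ?case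
      using 3 volume_potential_cong_AE[OF K PL PL TL[OF tk] P(3)] by simp
  next
    case (4 \<zeta>s i \<zeta> c d)
    have ni: "\<zeta>s ! i \<in> Linf \<Omega> \<times> Linf \<Omega>" using args_nth[OF 4(1,2)] .
    have u: "\<zeta>s[i := \<zeta>] \<in> args \<Omega> (Suc l)" "\<zeta>s[i := pot_comb c (\<zeta>s ! i) d \<zeta>] \<in> args \<Omega> (Suc l)"
      using args_update[OF 4(1) 4(3)] args_update[OF 4(1) pot_comb_Linf[OF ni 4(3)]] by auto
    have len: "length \<zeta>s = Suc l" using 4 by (simp add: args_def)
    show ?case
    proof (cases "i = l")
      case True
      have "P \<zeta> \<in> Linf \<Omega>" using 4 P(1) by blast
      then show ?thesis
        using True 4 u len
          volume_potential_comb_right[OF K TL[OF tk[OF 4(1)]] PL[OF 4(1)], of "P \<zeta>" k c d]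
        by (simp add: P(2) volume_potential_swap[of \<Omega> k G _ "T (take l \<zeta>s)"])
    next
      case False
      then have il: "i < l" using 4 by simp
      have "T ((take l \<zeta>s)[i := pot_comb c (take l \<zeta>s ! i) d \<zeta>])
          = (\<lambda>x. c * T (take l \<zeta>s) x + d * T ((take l \<zeta>s)[i := \<zeta>]) x)"
        using multilinear_opsD(4)[OF T tk[OF 4(1)] il 4(3)] .
      moreover have "T ((take l \<zeta>s)[i := \<zeta>]) \<in> Linf \<Omega>"
        using TL args_update tk 4 by blast
      ultimately show ?thesis
        using 4 u il len volume_potential_comb_right[OF K PL TL[OF tk], of \<zeta>s \<zeta>s "T ((take l \<zeta>s)[i := \<zeta>])" k c d]
        by (simp add: take_update_swap)
    qed
  qed auto
qed

lemma op_A_multilinear: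
  assumes "kernel_Linf_to_C \<Omega> G" "open \<Omega>" "bounded \<Omega>" "T \<in> multilinear_ops \<Omega> l"
  shows "op_A \<Omega> k G l T \<in> multilinear_ops \<Omega> (Suc l)"
proof -
  have "op_A \<Omega> k G l T = (\<lambda>\<zeta>s. if \<zeta>s \<in> args \<Omega> (Suc l)
      then volume_potential \<Omega> k G (fst (\<zeta>s ! l)) (T (take l \<zeta>s)) else 0)"
    by (simp add: fun_eq_iff op_A_def a_map_def)
  then show ?thesis
    using multilinear_potential[OF assms, of fst k]
    by (auto simp: pot_comb_def pot_AE_eq_def elim: eventually_mono)
qed

lemma op_B_multilinear:
  assumes "kernel_Linf_to_C \<Omega> G" "open \<Omega>" "bounded \<Omega>" "T \<in> multilinear_ops \<Omega> l"
  shows "op_B \<Omega> k G l T \<in> multilinear_ops \<Omega> (Suc l)"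
proof -
  have "op_B \<Omega> k G l T = (\<lambda>\<zeta>s. if \<zeta>s \<in> args \<Omega> (Suc l)
      then volume_potential \<Omega> k G (snd (\<zeta>s ! l)) (T (take l \<zeta>s)) else 0)"
    by (simp add: fun_eq_iff op_B_def b_map_def)
  then show ?thesis
    using multilinear_potential[OF assms, of snd k]
    by (auto simp: pot_comb_def pot_AE_eq_def elim: eventually_mono)
qed

lemma op_tensor_multilinear:
  assumes T: "T \<in> multilinear_ops \<Omega> l" and S: "S \<in> multilinear_ops \<Omega> j"
  shows "op_tensor \<Omega> l j T S \<in> multilinear_ops \<Omega> (l + j)"
proof (rule multilinear_opsI, goal_cases)
  case (2 \<zeta>s)
  then have "T (take l \<zeta>s) \<in> C_closure \<Omega>" "S (drop l \<zeta>s) \<in> C_closure \<Omega>"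
    using multilinear_opsD(2) T S args_take args_drop by blast+
  with 2 show ?case by (auto simp: op_tensor_def C_closure_def intro: continuous_on_mult)
next
  case (3 \<zeta>s \<zeta>s')
  then have "T (take l \<zeta>s) = T (take l \<zeta>s')" "S (drop l \<zeta>s) = S (drop l \<zeta>s')"
    by (meson multilinear_opsD(3) T S args_take args_drop list_all2_takeI list_all2_dropI)+
  with 3 show ?case by (simp add: op_tensor_def)
next
  case (4 \<zeta>s i \<zeta> c d)
  have ni: "\<zeta>s ! i \<in> Linf \<Omega> \<times> Linf \<Omega>" using args_nth[OF 4(1,2)] .
  have u: "\<zeta>s[i := \<zeta>] \<in> args \<Omega> (l + j)" "\<zeta>s[i := pot_comb c (\<zeta>s ! i) d \<zeta>] \<in> args \<Omega> (l + j)"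
    using args_update[OF 4(1) 4(3)] args_update[OF 4(1) pot_comb_Linf[OF ni 4(3)]] by auto
  have len: "length \<zeta>s = l + j" using 4 by (simp add: args_def)
  show ?case
  proof (cases "i < l")
    case True
    have "T ((take l \<zeta>s)[i := pot_comb c (take l \<zeta>s ! i) d \<zeta>])
          = (\<lambda>x. c * T (take l \<zeta>s) x + d * T ((take l \<zeta>s)[i := \<zeta>]) x)"
      using multilinear_opsD(4)[OF T args_take[OF 4(1)] True 4(3)] .
    then show ?thesis
      using True 4 u by (simp add: op_tensor_def take_update_swap drop_update_cancel algebra_simps)
  next
    case False
    then have "i - l < j" using 4 by simp
    then have "S ((drop l \<zeta>s)[i - l := pot_comb c (drop l \<zeta>s ! (i - l)) d \<zeta>])
          = (\<lambda>x. c * S (drop l \<zeta>s) x + d * S ((drop l \<zeta>s)[i - l := \<zeta>]) x)"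
      using multilinear_opsD(4)[OF S args_drop[OF 4(1)] _ 4(3)] by blast
    then show ?thesis
      using False 4 u len by (simp add: op_tensor_def drop_update_swap algebra_simps)
  qed
qed (simp add: op_tensor_def)

lemma zero_multilinear: "0 \<in> multilinear_ops \<Omega> l"
  by (auto simp: multilinear_ops_def C_closure_def zero_fun_def)

lemma add_multilinear:
  assumes "T \<in> multilinear_ops \<Omega> l" "S \<in> multilinear_ops \<Omega> l"
  shows "T + S \<in> multilinear_ops \<Omega> l"
proof (rule multilinear_opsI, goal_cases)
  case (2 \<zeta>s)
  then show ?case
    using multilinear_opsD(2)[OF assms(1)] multilinear_opsD(2)[OF assms(2)]
    by (auto simp: C_closure_def plus_fun_def intro: continuous_on_add)
next
  case (3 \<zeta>s \<zeta>s')
  then show ?case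
    using multilinear_opsD(3)[OF assms(1) 3] multilinear_opsD(3)[OF assms(2) 3] by simp
next
  case (4 \<zeta>s i \<zeta> c d)
  show ?case
    using multilinear_opsD(4)[OF assms(1) 4, of c d] multilinear_opsD(4)[OF assms(2) 4, of c d]
    by (simp add: fun_eq_iff algebra_simps)
qed (simp add: multilinear_opsD(1)[OF assms(1)] multilinear_opsD(1)[OF assms(2)])

lemma sum_multilinear:
  "(\<And>i. i \<in> I \<Longrightarrow> T i \<in> multilinear_ops \<Omega> l) \<Longrightarrow> sum T I \<in> multilinear_ops \<Omega> l"
  by (induction I rule: infinite_finite_induct) (auto intro: zero_multilinear add_multilinear)

lemma op_const_multilinear:
  "continuous_on (closure \<Omega>) v \<Longrightarrow> op_const \<Omega> v \<in> multilinear_ops \<Omega> 0"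
  by (rule multilinear_opsI) (auto simp: op_const_def C_closure_def intro: continuous_on_eq)

lemma formal_sumsI:
  assumes "\<And>l. F l \<in> multilinear_ops \<Omega> l" "\<And>l. l > N \<Longrightarrow> F l = 0"
  shows "F \<in> formal_sums \<Omega>"
proof -
  have "{l. F l \<noteq> 0} \<subseteq> {..N}" using assms(2) by (metis (mono_tags, lifting) atMost_iff mem_Collect_eq not_le subsetI)
  then show ?thesis using assms(1) finite_subset unfolding formal_sums_def by blast
qed

lemma formal_sumsE:
  assumes "F \<in> formal_sums \<Omega>"
  obtains N where "\<And>l. F l \<in> multilinear_ops \<Omega> l" "\<And>l. l > N \<Longrightarrow> F l = 0"
proof -
  have "finite {l. F l \<noteq> 0}" using assms by (simp add: formal_sums_def)
  then obtain N where "\<forall>l\<in>{l. F l \<noteq> 0}. l \<le> N" using finite_nat_set_iff_bounded_le by blast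
  then have "\<And>l. l > N \<Longrightarrow> F l = 0" by fastforce
  moreover have "\<And>l. F l \<in> multilinear_ops \<Omega> l" using assms by (simp add: formal_sums_def)
  ultimately show thesis using that by blast
qed

lemma formal_const_in: "continuous_on (closure \<Omega>) v \<Longrightarrow> formal_const \<Omega> v \<in> formal_sums \<Omega>"
  by (rule formal_sumsI[of _ _ 0]) (auto simp: formal_const_def op_const_multilinear zero_multilinear)

lemma formal_add_in:
  assumes "F \<in> formal_sums \<Omega>" "H \<in> formal_sums \<Omega>"
  shows "F + H \<in> formal_sums \<Omega>"
proof -
  obtain N where N: "\<And>l. F l \<in> multilinear_ops \<Omega> l" "\<And>l. l > N \<Longrightarrow> F l = 0"
    using assms(1) formal_sumsE by blast
  obtain M where M: "\<And>l. H l \<in> multilinear_ops \<Omega> l" "\<And>l. l > M \<Longrightarrow> H l = 0"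
    using assms(2) formal_sumsE by blast
  show ?thesis
    by (rule formal_sumsI[of _ _ "max N M"]) (auto simp: N M intro: add_multilinear)
qed

lemma op_A_zero: "op_A \<Omega> k G l 0 = 0"
  by (simp add: fun_eq_iff op_A_def a_map_def volume_potential_def)

lemma op_B_zero: "op_B \<Omega> k G l 0 = 0"
  by (simp add: fun_eq_iff op_B_def b_map_def volume_potential_def)

lemma formal_A_in:
  assumes "kernel_Linf_to_C \<Omega> G" "open \<Omega>" "bounded \<Omega>" "F \<in> formal_sums \<Omega>"
  shows "formal_A \<Omega> k G F \<in> formal_sums \<Omega>"
proof -
  obtain N where N: "\<And>l. F l \<in> multilinear_ops \<Omega> l" "\<And>l. l > N \<Longrightarrow> F l = 0"
    using assms(4) formal_sumsE by blast
  show ?thesis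
    by (rule formal_sumsI[of _ _ "Suc N"])
      (auto simp: formal_A_def N op_A_zero zero_multilinear op_A_multilinear[OF assms(1-3)] split: nat.splits)
qed

lemma formal_B_in:
  assumes "kernel_Linf_to_C \<Omega> G" "open \<Omega>" "bounded \<Omega>" "F \<in> formal_sums \<Omega>"
  shows "formal_B \<Omega> k G F \<in> formal_sums \<Omega>"
proof -
  obtain N where N: "\<And>l. F l \<in> multilinear_ops \<Omega> l" "\<And>l. l > N \<Longrightarrow> F l = 0"
    using assms(4) formal_sumsE by blast
  show ?thesis
    by (rule formal_sumsI[of _ _ "Suc N"])
      (auto simp: formal_B_def N op_B_zero zero_multilinear op_B_multilinear[OF assms(1-3)] split: nat.splits)
qed

lemma formal_tensor_in:
  assumes "F \<in> formal_sums \<Omega>" "H \<in> formal_sums \<Omega>"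
  shows "formal_tensor \<Omega> F H \<in> formal_sums \<Omega>"
proof -
  obtain N where N: "\<And>l. F l \<in> multilinear_ops \<Omega> l" "\<And>l. l > N \<Longrightarrow> F l = 0"
    using assms(1) formal_sumsE by blast
  obtain M where M: "\<And>l. H l \<in> multilinear_ops \<Omega> l" "\<And>l. l > M \<Longrightarrow> H l = 0"
    using assms(2) formal_sumsE by blast
  show ?thesis
  proof (rule formal_sumsI[of _ _ "N + M"])
    fix n
    show "formal_tensor \<Omega> F H n \<in> multilinear_ops \<Omega> n"
      unfolding formal_tensor_def
      by (rule sum_multilinear) (auto intro: op_tensor_multilinear N M)
  next
    fix n assume n: "n > N + M"
    have "op_tensor \<Omega> l j (F l) (H j) = 0" if "l + j = n" for l j
    proof -
      have "l > N \<or> j > M" using n that by linarith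
      then have "F l = 0 \<or> H j = 0" using N(2) M(2) by blast
      then show ?thesis by (auto simp: op_tensor_def fun_eq_iff)
    qed
    then show "formal_tensor \<Omega> F H n = 0"
      unfolding formal_tensor_def by (intro sum.neutral) auto
  qed
qed

theorem born_iterate_in_formal_sums:
  assumes "smooth_bounded_domain \<Omega>" "kernel_Linf_to_C \<Omega> G" "neumann_helmholtz_solution \<Omega> k g u0"
  shows "born_iterate \<Omega> k G u0 n \<in> formal_sums \<Omega>"
proof -
  have *: "open \<Omega>" "bounded \<Omega>" "continuous_on (closure \<Omega>) u0"
    using assms by (auto simp: smooth_bounded_domain_def neumann_helmholtz_solution_def)
  show ?thesis
    by (induction n)
      (simp_all only: born_iterate.simps formal_add_in formal_const_in formal_A_in formal_B_in formal_tensor_in * assms(2))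
qed

corollary forward_op_multilinear:
  assumes "smooth_bounded_domain \<Omega>" "kernel_Linf_to_C \<Omega> G" "neumann_helmholtz_solution \<Omega> k g u0"
  shows "forward_op \<Omega> k G u0 n \<in> multilinear_ops \<Omega> n"
  using born_iterate_in_formal_sums[OF assms, of n] by (simp add: forward_op_def formal_sums_def)

end

(* Each application of A or B raises the order by one, so the order-(n+1) part of an iterate depends
   only on the parts of order at most n of the previous one. Hence the order-l part of u_n does not
   depend on n once n is at least l, and the order-(n+1) part of the recursion for u_(n+1) involves
   only parts of u_n that are already forward operators. *)
theory Submission
  imports Defs
begin

text \<open>Triple tensors are nested to the left, so this is the distributivity needed to expand
  them. For infinite \<open>I\<close> both sums take the default value 0, and the tensor product of
  0 with \<open>S\<close> is 0.\<close>

lemma op_tensor_sum_left: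
  "op_tensor \<Omega> l j (sum T I) S = (\<Sum>i\<in>I. op_tensor \<Omega> l j (T i) S)"
proof -
  have add: "op_tensor \<Omega> l j (T1 + T2) S = op_tensor \<Omega> l j T1 S + op_tensor \<Omega> l j T2 S" for T1 T2
    by (simp add: fun_eq_iff op_tensor_def algebra_simps)
  have zero: "op_tensor \<Omega> l j 0 S = 0"
    by (simp add: fun_eq_iff op_tensor_def)
  show ?thesis
    by (induction I rule: infinite_finite_induct) (simp_all only: sum.infinite sum.empty sum.insert add zero not_False_eq_True)
qed

text \<open>A tensor product of order \<open>n\<close> only combines factors of orders
  \<open>l\<close> and \<open>j\<close> with \<open>l + j = n\<close>, hence of orders at most
  \<open>n\<close>.\<close>

lemma formal_tensor_cong:
  assumes "\<And>i. i \<le> n \<Longrightarrow> F i = F' i" "\<And>i. i \<le> n \<Longrightarrow> H i = H' i"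
  shows "formal_tensor \<Omega> F H n = formal_tensor \<Omega> F' H' n"
  unfolding formal_tensor_def by (rule sum.cong) (auto simp: assms)

lemma formal_tensor_triple:
  "formal_tensor \<Omega> (formal_tensor \<Omega> E F) H n =
    (\<Sum>(i1, i2, i3)\<in>{(i1, i2, i3). i1 + i2 + i3 = n \<and> i1 \<le> n \<and> i2 \<le> n \<and> i3 \<le> n}.
       op_tensor \<Omega> (i1 + i2) i3 (op_tensor \<Omega> i1 i2 (E i1) (F i2)) (H i3))"
proof -
  have fin: "finite {(l, j). l + j = m}" for m :: nat
    by (rule finite_subset[of _ "{..m} \<times> {..m}"]) auto
  have "formal_tensor \<Omega> (formal_tensor \<Omega> E F) H n =
      (\<Sum>p\<in>{(l, j). l + j = n}. \<Sum>q\<in>{(i1, i2). i1 + i2 = fst p}.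
         op_tensor \<Omega> (fst p) (snd p)
           (op_tensor \<Omega> (fst q) (snd q) (E (fst q)) (F (snd q))) (H (snd p)))"
    by (simp add: formal_tensor_def op_tensor_sum_left case_prod_unfold)
  also have "\<dots> =
      (\<Sum>(p, q)\<in>(SIGMA p:{(l, j). l + j = n}. {(i1, i2). i1 + i2 = fst p}).
         op_tensor \<Omega> (fst p) (snd p)
           (op_tensor \<Omega> (fst q) (snd q) (E (fst q)) (F (snd q))) (H (snd p)))"
    using fin by (intro sum.Sigma) auto
  also have "\<dots> =
      (\<Sum>(i1, i2, i3)\<in>{(i1, i2, i3). i1 + i2 + i3 = n \<and> i1 \<le> n \<and> i2 \<le> n \<and> i3 \<le> n}.
         op_tensor \<Omega> (i1 + i2) i3 (op_tensor \<Omega> i1 i2 (E i1) (F i2)) (H i3))"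
    \<comment> \<open>The inner order \<open>l\<close> is recovered as \<open>i1 + i2\<close>, so a
      nested pair of splittings carries the same data as an ordered triple.\<close>
    by (rule sum.reindex_bij_witness[
          where i = "\<lambda>(i1, i2, i3). ((i1 + i2, i3), (i1, i2))"
            and j = "\<lambda>(p, q). (fst q, snd q, snd p)"]) auto
  finally show ?thesis .
qed

text \<open>\<open>formal_A\<close> and \<open>formal_B\<close> have no part of order 0, so only the
  constant term of the recursion contributes.\<close>

lemma born_iterate_order_0: "born_iterate \<Omega> k G u0 n 0 = op_const \<Omega> u0"
  by (cases n) (simp_all add: formal_const_def formal_A_def formal_B_def)

lemma born_iterate_order_Suc:
  "born_iterate \<Omega> k G u0 (Suc n) (Suc l) =
     op_A \<Omega> k G l (born_iterate \<Omega> k G u0 n l)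
     + op_B \<Omega> k G l (formal_tensor \<Omega>
         (formal_tensor \<Omega> (born_iterate \<Omega> k G u0 n) (born_iterate \<Omega> k G u0 n))
         (born_iterate \<Omega> k G u0 n) l)"
  by (simp add: formal_const_def formal_A_def formal_B_def)

lemma born_iterate_stable_Suc:
  "l \<le> n \<Longrightarrow> born_iterate \<Omega> k G u0 (Suc n) l = born_iterate \<Omega> k G u0 n l"
proof (induction n arbitrary: l)
  case 0
  then show ?case by (simp only: born_iterate_order_0 le_zero_eq)
next
  case (Suc n)
  let ?u = "born_iterate \<Omega> k G u0"
  show ?case
  proof (cases l)
    case 0
    then show ?thesis by (simp only: born_iterate_order_0)
  next
    case (Suc m)
    \<comment> \<open>The tensor part of order \<open>m\<close> involves every order up to
      \<open>m\<close>, so the induction hypothesis is needed for all \<open>i \<le> m\<close>; here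
      \<open>Suc m \<le> Suc n\<close> gives \<open>i \<le> n\<close>.\<close>
    have eq: "?u (Suc n) i = ?u n i" if "i \<le> m" for i
      by (rule Suc.IH) (use Suc.prems Suc that in simp)
    have "formal_tensor \<Omega> (formal_tensor \<Omega> (?u (Suc n)) (?u (Suc n))) (?u (Suc n)) m
        = formal_tensor \<Omega> (formal_tensor \<Omega> (?u n) (?u n)) (?u n) m"
      by (intro formal_tensor_cong eq) auto
    then show ?thesis
      unfolding Suc by (simp only: born_iterate_order_Suc eq[OF order_refl])
  qed
qed

text \<open>The forward operator is the diagonal entry of order \<open>l\<close> in the iterate
  \<open>l\<close>; stability carries it unchanged from there up to the iterate
  \<open>n\<close>.\<close>

lemma born_iterate_eq_forward_op:
  "l \<le> n \<Longrightarrow> born_iterate \<Omega> k G u0 n l = forward_op \<Omega> k G u0 l"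
  by (induction n rule: dec_induct)
    (simp_all add: forward_op_def born_iterate_stable_Suc del: born_iterate.simps)

lemma forward_op_0: "forward_op \<Omega> k G u0 0 = op_const \<Omega> u0"
  by (simp add: forward_op_def born_iterate_order_0 del: born_iterate.simps)

lemma forward_op_Suc:
  fixes \<Omega> :: "'a::euclidean_space set" and k G u0
  defines "K \<equiv> forward_op \<Omega> k G u0"
  shows "K (Suc n) = op_A \<Omega> k G n (K n)
    + op_B \<Omega> k G n (\<Sum>(i1, i2, i3)\<in>{(i1, i2, i3). i1 + i2 + i3 = n \<and> i1 \<le> n \<and> i2 \<le> n \<and> i3 \<le> n}.
        op_tensor \<Omega> (i1 + i2) i3 (op_tensor \<Omega> i1 i2 (K i1) (K i2)) (K i3))"
proof -
  let ?u = "born_iterate \<Omega> k G u0 n"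
  have eq: "?u i = K i" if "i \<le> n" for i
    using that by (simp add: K_def born_iterate_eq_forward_op)
  \<comment> \<open>\<open>K\<close> is treated as a family indexed by order, with no bound on the
    orders at which it is nonzero; the part of order \<open>n\<close> sees only its entries up to
    \<open>n\<close>, where it agrees with the iterate.\<close>
  have "formal_tensor \<Omega> (formal_tensor \<Omega> ?u ?u) ?u n = formal_tensor \<Omega> (formal_tensor \<Omega> K K) K n"
    by (intro formal_tensor_cong eq) auto
  then have "K (Suc n) = op_A \<Omega> k G n (K n)
      + op_B \<Omega> k G n (formal_tensor \<Omega> (formal_tensor \<Omega> K K) K n)"
    \<comment> \<open>Instantiating at \<open>Suc n\<close> unfolds only the left-hand side and
      keeps the lower forward operators folded.\<close>
    unfolding K_def forward_op_def[of _ _ _ _ "Suc n"] born_iterate_order_Suc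
    by (simp only: born_iterate_eq_forward_op[OF order_refl])
  then show ?thesis by (simp only: formal_tensor_triple)
qed

theorem mainTheorem2:
  fixes \<Omega> :: "(real ^ 'd) set" and k :: real
    and u0 g :: "real ^ 'd \<Rightarrow> real" and G :: "real ^ 'd \<Rightarrow> real ^ 'd \<Rightarrow> real"
  defines "K \<equiv> forward_op \<Omega> k G u0"
  assumes dim: "CARD('d) > 2"
    and domain: "smooth_bounded_domain \<Omega>"
    and k: "k > 0"
    and background: "neumann_helmholtz_solution \<Omega> k g u0"
    and green: "neumann_greens_function \<Omega> k G"
    and kernel: "kernel_Linf_to_C \<Omega> G"
  shows "K 0 = op_const \<Omega> u0 \<and>
    K 1 = op_A \<Omega> k G 0 (op_const \<Omega> u0)
        + op_B \<Omega> k G 0 (op_tensor \<Omega> 0 0 (op_tensor \<Omega> 0 0 (op_const \<Omega> u0) (op_const \<Omega> u0)) (op_const \<Omega> u0)) \<and>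
    (\<forall>n. K (Suc n) = op_A \<Omega> k G n (K n)
        + op_B \<Omega> k G n (\<Sum>(i1, i2, i3)\<in>{(i1, i2, i3). i1 + i2 + i3 = n \<and> i1 \<le> n \<and> i2 \<le> n \<and> i3 \<le> n}.
            op_tensor \<Omega> (i1 + i2) i3 (op_tensor \<Omega> i1 i2 (K i1) (K i2)) (K i3)))"
proof (intro conjI allI)
  show K0: "K 0 = op_const \<Omega> u0"
    unfolding K_def by (rule forward_op_0)
  show step: "K (Suc n) = op_A \<Omega> k G n (K n)
        + op_B \<Omega> k G n (\<Sum>(i1, i2, i3)\<in>{(i1, i2, i3). i1 + i2 + i3 = n \<and> i1 \<le> n \<and> i2 \<le> n \<and> i3 \<le> n}.
            op_tensor \<Omega> (i1 + i2) i3 (op_tensor \<Omega> i1 i2 (K i1) (K i2)) (K i3))" for n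
    unfolding K_def by (rule forward_op_Suc)
  \<comment> \<open>For \<open>n = 0\<close> the sum has a single term, which gives the formula for
    \<open>K 1\<close>.\<close>
  have "{(i1, i2, i3). i1 + i2 + i3 = 0 \<and> i1 \<le> 0 \<and> i2 \<le> 0 \<and> i3 \<le> 0} = {(0::nat, 0::nat, 0::nat)}"
    by auto
  then show "K 1 = op_A \<Omega> k G 0 (op_const \<Omega> u0)
        + op_B \<Omega> k G 0 (op_tensor \<Omega> 0 0 (op_tensor \<Omega> 0 0 (op_const \<Omega> u0) (op_const \<Omega> u0)) (op_const \<Omega> u0))"
    using step[of 0] by (simp add: K0)
qed

end
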